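(* Let $B\ge 1$, let $x_{\rm tr}\in\mathbb{C}^B\setminus\{0\}$ be a fixed training vector, let $\sigma_x^2,\sigma_w^2>0$, and let $h\in\mathbb{C}\setminus\{0\}$ be a deterministic (unknown) channel coefficient. Then the MVU filter $f_{\rm MVU}=x_{\rm tr}/\|x_{\rm tr}\|^2$ is an optimal channel estimator for the task of minimizing $\left[\mathrm{MSE}_{xe}^{dc}(\mathrm{ZF})\right]_0$; that is, $f_{\rm MVU}$ minimizes $f\mapsto\left[\mathrm{MSE}_{xe}^{dc}(\mathrm{ZF})\right]_0(f)$ over $f\in\mathbb{C}^B\setminus\{0\}$.
   Context: Training model: $y_{\rm tr}=h\,x_{\rm tr}+w_{\rm tr}$, where $w_{\rm tr}\in\mathbb{C}^B$ has i.i.d. circularly symmetric complex Gaussian entries of mean $0$ and variance $\sigma_w^2$. A linear channel estimator is determined by a filter $f\in\mathbb{C}^B$ through $\hat h=f^H y_{\rm tr}$. The data symbols have mean zero and power $\sigma_x^2$. The zeroth order excess MSE of the zero-forcing equalizer for a deterministic channel is defined as $$\left[\mathrm{MSE}_{xe}^{dc}(\mathrm{ZF})\right]_0(f)=\frac{E[|\hat h-h|^2]}{E[|\hat h|^2]}\left(\sigma_x^2+\frac{\sigma_w^2}{|h|^2}\right) =\frac{|h|^2|f^Hx_{\rm tr}-1|^2+\sigma_w^2\|f\|^2}{|h|^2|f^Hx_{\rm tr}|^2+\sigma_w^2\|f\|^2}\left(\sigma_x^2+\frac{\sigma_w^2}{|h|^2}\right),$$ with expectations over $w_{\rm tr}$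 ($h$ is fixed). *)

theory Defs
  imports "HOL-Probability.Probability"
begin

text \<open>The scalar \<open>f\<^sup>H y\<close>; the library inner product on \<open>complex ^ 'b\<close> is only the real part of it.\<close>

definition herm_dot :: "complex ^ 'b \<Rightarrow> complex ^ 'b \<Rightarrow> complex" where
  "herm_dot f y = (\<Sum>i\<in>UNIV. cnj (f $ i) * y $ i)"

text \<open>The law \<open>CN(0, v)\<close>: real and imaginary part are independent real Gaussians which share the
  variance \<open>v\<close> equally, so that \<open>E \<bar>Z\<bar>\<^sup>2 = v\<close>. Note that
  \<^const>\<open>normal_density\<close> takes a standard deviation.\<close>

definition circ_sym_complex_gaussian :: "'w measure \<Rightarrow> real \<Rightarrow> ('w \<Rightarrow> complex) \<Rightarrow> bool" where
  "circ_sym_complex_gaussian M v Z \<longleftrightarrow>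
     prob_space.indep_var M borel (\<lambda>\<omega>. Re (Z \<omega>)) borel (\<lambda>\<omega>. Im (Z \<omega>)) \<and>
     distributed M lborel (\<lambda>\<omega>. Re (Z \<omega>)) (normal_density 0 (sqrt (v / 2))) \<and>
     distributed M lborel (\<lambda>\<omega>. Im (Z \<omega>)) (normal_density 0 (sqrt (v / 2)))"

definition iid_circ_sym_complex_gaussian ::
    "'w measure \<Rightarrow> real \<Rightarrow> ('w \<Rightarrow> complex ^ 'b) \<Rightarrow> bool" where
  "iid_circ_sym_complex_gaussian M v w \<longleftrightarrow>
     prob_space.indep_vars M (\<lambda>_. borel) (\<lambda>i \<omega>. w \<omega> $ i) UNIV \<and>
     (\<forall>i. circ_sym_complex_gaussian M v (\<lambda>\<omega>. w \<omega> $ i))"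

definition training_output ::
    "complex \<Rightarrow> complex ^ 'b \<Rightarrow> ('w \<Rightarrow> complex ^ 'b) \<Rightarrow> 'w \<Rightarrow> complex ^ 'b" where
  "training_output h x w \<omega> = h *s x + w \<omega>"

definition channel_estimate ::
    "complex \<Rightarrow> complex ^ 'b \<Rightarrow> ('w \<Rightarrow> complex ^ 'b) \<Rightarrow> complex ^ 'b \<Rightarrow> 'w \<Rightarrow> complex" where
  "channel_estimate h x w f \<omega> = herm_dot f (training_output h x w \<omega>)"

text \<open>Here \<open>vx\<close> is the power of the data symbols and \<open>vw\<close> the variance of the noise entries;
  these are the variances themselves, not standard deviations.\<close>

definition zf_excess_mse0 ::
    "'w measure \<Rightarrow> real \<Rightarrow> real \<Rightarrow> complex \<Rightarrow> complex ^ 'b \<Rightarrow> ('w \<Rightarrow> complex ^ 'b) \<Rightarrow>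
     complex ^ 'b \<Rightarrow> real" where
  "zf_excess_mse0 M vx vw h x w f =
     (\<integral>\<omega>. (cmod (channel_estimate h x w f \<omega> - h))\<^sup>2 \<partial>M) /
     (\<integral>\<omega>. (cmod (channel_estimate h x w f \<omega>))\<^sup>2 \<partial>M) *
     (vx + vw / (cmod h)\<^sup>2)"

definition mvu_filter :: "complex ^ 'b \<Rightarrow> complex ^ 'b" where
  "mvu_filter x = x /\<^sub>R (norm x)\<^sup>2"

end

theory Submission
  imports Defs
begin

text \<open>
  Write \<open>t = f\<^sup>H x\<close>, \<open>n = \<parallel>f\<parallel>\<close> and \<open>N = \<parallel>x\<parallel>\<^sup>2\<close>. Uncorrelatedness of the noise turns the two
  expectations into \<open>\<bar>h\<bar>\<^sup>2 \<bar>t - 1\<bar>\<^sup>2 + \<sigma>\<^sub>w\<^sup>2 n\<^sup>2\<close> and \<open>\<bar>h\<bar>\<^sup>2 \<bar>t\<bar>\<^sup>2 + \<sigma>\<^sub>w\<^sup>2 n\<^sup>2\<close>. Dropping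
  \<open>\<bar>t - 1\<bar>\<^sup>2 \<ge> 0\<close> and using Cauchy-Schwarz, \<open>\<bar>t\<bar>\<^sup>2 \<le> n\<^sup>2 N\<close>, bounds their ratio from below by
  \<open>\<sigma>\<^sub>w\<^sup>2 / (\<bar>h\<bar>\<^sup>2 N + \<sigma>\<^sub>w\<^sup>2)\<close>; the MVU filter has \<open>t = 1\<close> and equality in Cauchy-Schwarz, so it
  attains this bound.
\<close>

text \<open>\<open>has_bochner_integral\<close> carries integrability together with the value, so
  the later linear combinations need no separate integrability proofs.\<close>

lemma normal_distributed_moments:
  assumes "prob_space M" and "\<sigma> > 0"
    and D: "distributed M lborel X (normal_density 0 \<sigma>)"
  shows "has_bochner_integral M X 0"
    and "has_bochner_integral M (\<lambda>\<omega>. (X \<omega>)\<^sup>2) (\<sigma>\<^sup>2)"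
proof -
  interpret prob_space M by fact
  have int1: "integrable M X"
    using integrable_normal_moment_nz_1[OF \<open>\<sigma> > 0\<close>, of 0]
    by (intro distributed_integrable_var[OF D]) auto
  have mean: "expectation X = 0"
    by (rule normal_distributed_expectation[OF \<open>\<sigma> > 0\<close> D])
  show "has_bochner_integral M X 0"
    using int1 mean by (simp add: has_bochner_integral_iff)
  have "integrable M (\<lambda>\<omega>. (X \<omega>)\<^sup>2)"
    using integrable_normal_moment[OF \<open>\<sigma> > 0\<close>, of 0 2]
    by (subst distributed_integrable[OF D, of "\<lambda>x. x\<^sup>2", symmetric]) auto
  moreover have "expectation (\<lambda>\<omega>. (X \<omega>)\<^sup>2) = \<sigma>\<^sup>2"
    using normal_distributed_variance[OF \<open>\<sigma> > 0\<close> D] by (simp add: mean)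
  ultimately show "has_bochner_integral M (\<lambda>\<omega>. (X \<omega>)\<^sup>2) (\<sigma>\<^sup>2)"
    by (simp add: has_bochner_integral_iff)
qed

text \<open>Real and imaginary part each contribute \<open>v / 2\<close> to the second moment. It is
  written as \<open>Z * cnj Z\<close>, with complex values, to serve as the diagonal case of the
  covariances \<open>w $ i * cnj (w $ j)\<close>.\<close>

lemma circ_sym_complex_gaussian_moments:
  assumes "prob_space M" and "v > 0" and Z: "circ_sym_complex_gaussian M v Z"
  shows "has_bochner_integral M Z 0"
    and "has_bochner_integral M (\<lambda>\<omega>. Z \<omega> * cnj (Z \<omega>)) (of_real v)"
proof -
  have \<sigma>: "sqrt (v / 2) > 0" using \<open>v > 0\<close> by simp
  note re = normal_distributed_moments[OF \<open>prob_space M\<close> \<sigma>, of "\<lambda>\<omega>. Re (Z \<omega>)"]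
  note im = normal_distributed_moments[OF \<open>prob_space M\<close> \<sigma>, of "\<lambda>\<omega>. Im (Z \<omega>)"]
  have D: "distributed M lborel (\<lambda>\<omega>. Re (Z \<omega>)) (normal_density 0 (sqrt (v / 2)))"
    "distributed M lborel (\<lambda>\<omega>. Im (Z \<omega>)) (normal_density 0 (sqrt (v / 2)))"
    using Z by (auto simp: circ_sym_complex_gaussian_def)
  have "has_bochner_integral M (\<lambda>\<omega>. of_real (Re (Z \<omega>)) + \<i> * of_real (Im (Z \<omega>)))
      (of_real 0 + \<i> * of_real 0)"
    by (intro has_bochner_integral_add has_bochner_integral_mult_right
        has_bochner_integral_of_real re(1) im(1) D)
  then show "has_bochner_integral M Z 0"
    by (simp flip: complex_eq)
  have "has_bochner_integral M (\<lambda>\<omega>. complex_of_real ((Re (Z \<omega>))\<^sup>2 + (Im (Z \<omega>))\<^sup>2))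
      (of_real ((sqrt (v / 2))\<^sup>2 + (sqrt (v / 2))\<^sup>2))"
    by (intro has_bochner_integral_of_real has_bochner_integral_add re(2) im(2) D)
  then show "has_bochner_integral M (\<lambda>\<omega>. Z \<omega> * cnj (Z \<omega>)) (of_real v)"
    using \<open>v > 0\<close> by (simp add: complex_mult_cnj)
qed

lemma indep_vars_mult_cnj:
  fixes Z :: "'i \<Rightarrow> 'w \<Rightarrow> complex"
  assumes "prob_space M" and ind: "prob_space.indep_vars M (\<lambda>_. borel) Z UNIV"
    and int: "\<And>i. has_bochner_integral M (Z i) (\<mu> i)" and "i \<noteq> j"
  shows "has_bochner_integral M (\<lambda>\<omega>. Z i \<omega> * cnj (Z j \<omega>)) (\<mu> i * cnj (\<mu> j))"
proof -
  interpret prob_space M by fact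
  \<comment> \<open>Independence is preserved by one map per index; since
    \<open>i \<noteq> j\<close>, this choice conjugates only the second factor.\<close>
  define Y where "Y k = (if k = i then (\<lambda>z. z) else cnj)" for k
  have Y_borel: "Y k \<in> borel \<rightarrow>\<^sub>M borel" for k
    by (simp add: Y_def borel_measurable_continuous_onI continuous_on_cnj continuous_on_id)
  have ind_Y: "indep_vars (\<lambda>_. borel) (\<lambda>k \<omega>. Y k (Z k \<omega>)) {i, j}"
    by (rule indep_vars_compose2[OF indep_vars_subset[OF ind] Y_borel]) simp
  have int_Y: "has_bochner_integral M (\<lambda>\<omega>. Y k (Z k \<omega>)) (Y k (\<mu> k))" for k
    using int[of k] by (auto simp: Y_def intro: has_bochner_integral_cnj)
  have int_Y': "integrable M (\<lambda>\<omega>. Y k (Z k \<omega>))" for k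
    using int_Y by (rule integrable.intros)
  show ?thesis
    using indep_vars_lebesgue_integral[OF _ ind_Y int_Y']
      indep_vars_integrable[OF _ ind_Y int_Y'] \<open>i \<noteq> j\<close> int_Y[of i] int_Y[of j]
    by (simp add: has_bochner_integral_iff Y_def)
qed

text \<open>In the expansion of the squared modulus the cross terms vanish because the noise has
  mean zero. The offset \<open>a\<close> is left free so that the same formula serves the numerator
  and the denominator of the objective.\<close>

lemma expectation_cmod_add_herm_dot:
  fixes w :: "'w \<Rightarrow> complex ^ 'b"
  assumes "prob_space M" and "v > 0" and w: "iid_circ_sym_complex_gaussian M v w"
  shows "(\<integral>\<omega>. (cmod (a + herm_dot f (w \<omega>)))\<^sup>2 \<partial>M) = (cmod a)\<^sup>2 + v * (norm f)\<^sup>2"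
proof -
  interpret prob_space M by fact
  define S where "S \<omega> = herm_dot f (w \<omega>)" for \<omega>
  have mean: "has_bochner_integral M (\<lambda>\<omega>. w \<omega> $ i) 0"
    and var: "has_bochner_integral M (\<lambda>\<omega>. w \<omega> $ i * cnj (w \<omega> $ i)) (of_real v)" for i
    using circ_sym_complex_gaussian_moments[OF assms(1,2)] w
    by (auto simp: iid_circ_sym_complex_gaussian_def)
  have cov: "has_bochner_integral M (\<lambda>\<omega>. w \<omega> $ i * cnj (w \<omega> $ j)) (if i = j then of_real v else 0)"
    for i j
    using var[of i] indep_vars_mult_cnj[OF \<open>prob_space M\<close> _ mean, where i = i and j = j] w
    by (auto simp: iid_circ_sym_complex_gaussian_def)
  have S0: "has_bochner_integral M S 0"
  proof -
    have "has_bochner_integral M (\<lambda>\<omega>. \<Sum>i\<in>UNIV. cnj (f $ i) * w \<omega> $ i)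
        (\<Sum>i\<in>UNIV. cnj (f $ i) * 0)"
      by (intro has_bochner_integral_sum has_bochner_integral_mult_right mean)
    then show ?thesis
      by (simp add: S_def[abs_def] herm_dot_def)
  qed
  \<comment> \<open>The second moment of \<open>S\<close> as a double sum over covariances, of which
    only the diagonal survives.\<close>
  have "has_bochner_integral M
      (\<lambda>\<omega>. \<Sum>i\<in>UNIV. \<Sum>j\<in>UNIV. (cnj (f $ i) * f $ j) * (w \<omega> $ i * cnj (w \<omega> $ j)))
      (\<Sum>i\<in>UNIV. \<Sum>j\<in>UNIV. (cnj (f $ i) * f $ j) * (if i = j then of_real v else 0))"
    by (intro has_bochner_integral_sum has_bochner_integral_mult_right cov)
  also have "(\<lambda>\<omega>. \<Sum>i\<in>UNIV. \<Sum>j\<in>UNIV. (cnj (f $ i) * f $ j) * (w \<omega> $ i * cnj (w \<omega> $ j)))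
      = (\<lambda>\<omega>. S \<omega> * cnj (S \<omega>))"
    unfolding S_def herm_dot_def cnj_sum sum_product by (simp add: mult_ac)
  also have "(\<Sum>i\<in>UNIV. \<Sum>j\<in>UNIV. (cnj (f $ i) * f $ j) * (if i = j then of_real v else 0))
      = of_real (v * (norm f)\<^sup>2)"
    by (simp add: if_distrib mult_ac norm_vec_def L2_set_def sum_nonneg sum_distrib_left
        flip: complex_norm_square cong: if_cong)
  \<comment> \<open>These are the four terms of \<open>(a + S) * cnj (a + S)\<close>. The zeros stay
    unevaluated so that the value matches the integration rules term by term.\<close>
  finally have "has_bochner_integral M
      (\<lambda>\<omega>. a * cnj a + a * cnj (S \<omega>) + cnj a * S \<omega> + S \<omega> * cnj (S \<omega>))
      (a * cnj a + a * cnj 0 + cnj a * 0 + of_real (v * (norm f)\<^sup>2))"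
    by (intro has_bochner_integral_add has_bochner_integral_mult_right has_bochner_integral_cnj S0)
       (simp_all add: has_bochner_integral_iff prob_space)
  then have "has_bochner_integral M (\<lambda>\<omega>. complex_of_real ((cmod (a + S \<omega>))\<^sup>2))
      (of_real ((cmod a)\<^sup>2 + v * (norm f)\<^sup>2))"
    by (simp add: complex_norm_square algebra_simps del: of_real_power)
  \<comment> \<open>Taking real parts returns from the complex computation to the real
    expectation.\<close>
  from has_bochner_integral_integral_eq[OF has_bochner_integral_Re[OF this]]
  show ?thesis
    by (simp add: S_def)
qed

lemma herm_dot_training_output:
  "herm_dot f (training_output h x w \<omega>) = h * herm_dot f x + herm_dot f (w \<omega>)"
  by (simp add: herm_dot_def training_output_def algebra_simps sum.distrib sum_distrib_left)

text \<open>The offsets are \<open>h * (herm_dot f x - 1)\<close> for the estimation error and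
  \<open>h * herm_dot f x\<close> for the estimate itself.\<close>

lemma zf_excess_mse0_eq:
  fixes w :: "'w \<Rightarrow> complex ^ 'b"
  assumes "prob_space M" and "vw > 0" and "iid_circ_sym_complex_gaussian M vw w"
  shows "zf_excess_mse0 M vx vw h x w f =
    ((cmod h)\<^sup>2 * (cmod (herm_dot f x - 1))\<^sup>2 + vw * (norm f)\<^sup>2) /
    ((cmod h)\<^sup>2 * (cmod (herm_dot f x))\<^sup>2 + vw * (norm f)\<^sup>2) * (vx + vw / (cmod h)\<^sup>2)"
proof -
  have "channel_estimate h x w f \<omega> - h = h * (herm_dot f x - 1) + herm_dot f (w \<omega>)" for \<omega>
    by (simp add: channel_estimate_def herm_dot_training_output algebra_simps)
  moreover have "channel_estimate h x w f \<omega> = h * herm_dot f x + herm_dot f (w \<omega>)" for \<omega>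
    by (simp add: channel_estimate_def herm_dot_training_output)
  ultimately show ?thesis
    by (simp only: zf_excess_mse0_def expectation_cmod_add_herm_dot[OF assms] norm_mult
        power_mult_distrib)
qed

text \<open>Cauchy-Schwarz: the triangle inequality passes to the moduli of the entries, where the
  real inequality for \<open>L2_set\<close> applies.\<close>

lemma cmod_herm_dot_le: "cmod (herm_dot f x) \<le> norm f * norm x"
proof -
  have "cmod (herm_dot f x) \<le> (\<Sum>i\<in>UNIV. \<bar>cmod (f $ i)\<bar> * \<bar>cmod (x $ i)\<bar>)"
    unfolding herm_dot_def by (rule order_trans[OF norm_sum]) (simp add: norm_mult)
  also have "\<dots> \<le> norm f * norm x"
    unfolding norm_vec_def by (rule L2_set_mult_ineq)
  finally show ?thesis .
qed

lemma herm_dot_self: "herm_dot x x = of_real ((norm x)\<^sup>2)"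
  by (simp add: herm_dot_def norm_vec_def L2_set_def sum_nonneg mult.commute
      del: of_real_power flip: complex_norm_square)

lemma herm_dot_mvu_filter:
  assumes "x \<noteq> 0"
  shows "herm_dot (mvu_filter x) x = 1"
proof -
  have "herm_dot (mvu_filter x) x = herm_dot x x /\<^sub>R (norm x)\<^sup>2"
    by (simp add: herm_dot_def mvu_filter_def scaleR_sum_right)
  also have "\<dots> = 1"
    using assms by (simp add: herm_dot_self scaleR_conv_of_real)
  finally show ?thesis .
qed

text \<open>At \<open>x = 0\<close> both sides are 0, by the convention for division by
  zero.\<close>

lemma norm_mvu_filter: "(norm (mvu_filter x))\<^sup>2 = 1 / (norm x)\<^sup>2"
  by (simp add: mvu_filter_def power2_eq_square divide_simps)

theorem proposition3:
  fixes M :: "'w measure"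
    and w :: "'w \<Rightarrow> complex ^ 'b"
    and x :: "complex ^ 'b"
    and h :: complex
    and vx vw :: real
  assumes "prob_space M"
    and "vx > 0" and "vw > 0"
    and "x \<noteq> 0"
    and "h \<noteq> 0"
    and "iid_circ_sym_complex_gaussian M vw w"
  shows "is_arg_min (zf_excess_mse0 M vx vw h x w) (\<lambda>f. f \<noteq> 0) (mvu_filter x)"
proof -
  note eq = zf_excess_mse0_eq[OF \<open>prob_space M\<close> \<open>vw > 0\<close> assms(6)]
  define H where "H = (cmod h)\<^sup>2"
  define N where "N = (norm x)\<^sup>2"
  have pos: "H > 0" "N > 0"
    using \<open>h \<noteq> 0\<close> \<open>x \<noteq> 0\<close> by (simp_all add: H_def N_def)
  have scale: "vx + vw / H > 0"
    using \<open>vx > 0\<close> \<open>vw > 0\<close> pos by (simp add: add_pos_pos)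
  \<comment> \<open>The ratio is \<open>(vw / N) / (H + vw / N)\<close>; multiplying through by
    \<open>N\<close> gives the stated form.\<close>
  have mvu: "zf_excess_mse0 M vx vw h x w (mvu_filter x) = vw / (H * N + vw) * (vx + vw / H)"
    using pos \<open>vw > 0\<close> unfolding eq herm_dot_mvu_filter[OF \<open>x \<noteq> 0\<close>] norm_mvu_filter
    by (fold H_def N_def) (simp add: divide_simps)
  have "zf_excess_mse0 M vx vw h x w (mvu_filter x) \<le> zf_excess_mse0 M vx vw h x w f"
    if "f \<noteq> 0" for f
  proof -
    define n where "n = (norm f)\<^sup>2"
    define T where "T = (cmod (herm_dot f x))\<^sup>2"
    define D where "D = (cmod (herm_dot f x - 1))\<^sup>2"
    have "n > 0" "T \<ge> 0" "D \<ge> 0"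
      using that by (simp_all add: n_def T_def D_def)
    have "T \<le> n * N"
      using power_mono[OF cmod_herm_dot_le, of f x 2]
      by (simp add: T_def n_def N_def power_mult_distrib)
    \<comment> \<open>This chain proves the bound on the ratio in cross-multiplied form.\<close>
    then have "vw * (H * T + vw * n) \<le> vw * (H * (n * N) + vw * n)"
      using pos \<open>vw > 0\<close> by (intro mult_left_mono add_right_mono) auto
    also have "\<dots> = vw * n * (H * N + vw)"
      by (simp add: algebra_simps)
    also have "\<dots> \<le> (H * D + vw * n) * (H * N + vw)"
      using pos \<open>vw > 0\<close> \<open>D \<ge> 0\<close> by (intro mult_right_mono) auto
    \<comment> \<open>Here \<open>f \<noteq> 0\<close> enters: \<open>n > 0\<close> makes the
      denominator \<open>H * T + vw * n\<close> positive even when \<open>T = 0\<close>.\<close>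
    finally have "vw / (H * N + vw) \<le> (H * D + vw * n) / (H * T + vw * n)"
      using pos \<open>vw > 0\<close> \<open>n > 0\<close> \<open>T \<ge> 0\<close>
      by (subst frac_le_eq) (simp_all add: frac_le_eq divide_nonpos_pos add_pos_pos add_nonneg_pos
          less_imp_neq[symmetric] mult_ac)
    then show ?thesis
      unfolding mvu eq[where f = f] H_def[symmetric] n_def[symmetric] T_def[symmetric]
        D_def[symmetric]
      by (rule mult_right_mono) (use scale in simp)
  qed
  moreover have "mvu_filter x \<noteq> 0"
    using \<open>x \<noteq> 0\<close> by (simp add: mvu_filter_def)
  ultimately show ?thesis
    by (auto simp: is_arg_min_def not_less)
qed

end
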